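(* For all integers $r\geq 2$ and $k_1\geq k_2\geq\cdots\geq k_r\geq 2$, \[ M_r(k_1,\dots,k_r)\leq \frac{(k_1+k_2-2)(k_1+k_2-3)}{(k_1-1)(k_2-1)}\binom{k_1+\cdots+k_r-2r}{k_1-2,\dots,k_r-2}. \] In particular, for all integers $r,k\geq 2$, \[ M_r(k)\leq \left(4-\frac{2}{k-1}\right)\frac{(r(k-2))!}{((k-2)!)^r}. \]
   Context: For each integer $r\geq 2$, $M_r:\mathbb{Z}_{\geq 2}^r\to\mathbb{Z}_{\geq 0}$ denotes the family of functions uniquely determined by: (i) $M_2(k_1,k_2)=\binom{k_1+k_2-2}{k_1-1}$ for $k_1,k_2\geq 2$; (ii) for $r\geq 2$ and $k_1,\dots,k_r\geq 2$, inserting a coordinate equal to $2$ at any position of $(k_1,\dots,k_r)$ gives an $(r+1)$-tuple at which $M_{r+1}$ equals $M_r(k_1,\dots,k_r)$; (iii) for $k_1,\dots,k_r\geq 3$, $M_r(k_1,\dots,k_r)=\sum_{i=1}^r M_r(k_1,\dots,k_i-1,\dots,k_r)$ (the $i$-th coordinate decreased by $1$). $M_r(k)$ means $M_r(k,\dots,k)$. The multinomial coefficient $\binom{n}{a_1,\dots,a_r}$ with $a_1+\cdots+a_r=n$, $a_i\geq 0$, equals $\frac{n!}{a_1!\cdots a_r!}$. *)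

theory Defs
  imports Complex_Main
begin

text \<open>
  The family \<open>M\<^sub>r\<close> is a single function on lists, with \<open>M\<^sub>r\<close> its restriction to lists of
  length \<open>r\<close>. Only values at lists of length at least 2 with all entries at least 2 are
  constrained; on these \<open>M_family\<close> determines \<open>M\<close> uniquely (\<open>M_family_unique\<close>), and
  such an \<open>M\<close> exists (\<open>M_family_exists\<close>).
\<close>

definition M_family :: "(nat list \<Rightarrow> nat) \<Rightarrow> bool" where
  "M_family M \<longleftrightarrow>
     (\<forall>k1 k2. k1 \<ge> 2 \<longrightarrow> k2 \<ge> 2 \<longrightarrow> M [k1, k2] = (k1 + k2 - 2) choose (k1 - 1)) \<and>
     (\<forall>xs ys. length (xs @ ys) \<ge> 2 \<longrightarrow> (\<forall>k\<in>set (xs @ ys). k \<ge> 2) \<longrightarrow>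
        M (xs @ 2 # ys) = M (xs @ ys)) \<and>
     (\<forall>ks. length ks \<ge> 2 \<longrightarrow> (\<forall>k\<in>set ks. k \<ge> 3) \<longrightarrow>
        M ks = (\<Sum>i<length ks. M (ks[i := ks ! i - 1])))"

text \<open>Meaningful when \<open>sum_list as = n\<close>.\<close>

definition multinomial :: "nat \<Rightarrow> nat list \<Rightarrow> real" where
  "multinomial n as = fact n / (\<Prod>a\<leftarrow>as. fact a)"

lemma sum_list_decrement_less:
  fixes ks :: "nat list"
  assumes "i < length ks" "ks ! i > 0"
  shows "sum_list (ks[i := ks ! i - 1]) < sum_list ks"
proof -
  have "ks ! i \<le> sum_list ks"
    using assms(1) by (simp add: elem_le_sum_list)
  then show ?thesis
    using assms by (simp add: sum_list_update)
qed

lemma sum_list_filter_le: "sum_list (filter P ks) \<le> sum_list (ks :: nat list)"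
  by (induction ks) auto

function M_witness :: "nat list \<Rightarrow> nat" where
  "M_witness ks = (let fs = filter (\<lambda>k. 2 < k) ks in
     if length fs = 0 then 2
     else if length fs = 1 then hd fs
     else (\<Sum>i<length fs. M_witness (fs[i := fs ! i - 1])))"
  by auto
termination
proof (relation "measure sum_list")
  fix ks :: "nat list" and fs i
  assume fs: "fs = filter (\<lambda>k. 2 < k) ks" and i: "i \<in> {..<length fs}"
  have "fs ! i \<in> set fs"
    using i by simp
  then have "fs ! i > 0"
    using fs by auto
  then have "sum_list (fs[i := fs ! i - 1]) < sum_list fs"
    using i by (intro sum_list_decrement_less) auto
  then show "(fs[i := fs ! i - 1], ks) \<in> measure sum_list"
    using fs sum_list_filter_le[of "\<lambda>k. 2 < k" ks] by simp
qed simp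

declare M_witness.simps [simp del]

lemma M_witness_step:
  assumes "length ks \<ge> 2" "\<forall>k\<in>set ks. k \<ge> 3"
  shows "M_witness ks = (\<Sum>i<length ks. M_witness (ks[i := ks ! i - 1]))"
proof -
  have "filter (\<lambda>k. 2 < k) ks = ks"
    using assms(2) by (intro filter_True) auto
  then show ?thesis
    using assms(1) by (subst M_witness.simps) (auto simp: Let_def)
qed

lemma M_witness_binomial:
  assumes "a \<ge> 2" "b \<ge> 2"
  shows "M_witness [a, b] = (a + b - 2) choose (a - 1)"
  using assms
proof (induction "a + b" arbitrary: a b rule: less_induct)
  case less
  consider "a = 2" | "b = 2" | "a \<ge> 3" "b \<ge> 3"
    using less.prems by linarith
  then show ?case
  proof cases
    case 1
    then show ?thesis
      using less.prems by (subst M_witness.simps) (auto simp: Let_def)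
  next
    case 2
    have "a choose (a - 1) = a"
      using less.prems binomial_symmetric[of 1 a] by simp
    then show ?thesis
      using 2 less.prems by (subst M_witness.simps) (auto simp: Let_def)
  next
    case 3
    obtain c where c: "a = Suc (Suc c)"
      using 3 by (metis less.prems(1) add_2_eq_Suc le_Suc_ex)
    obtain d where d: "b = Suc (Suc d)"
      using 3 by (metis less.prems(2) add_2_eq_Suc le_Suc_ex)
    have "M_witness [a, b] = M_witness [a - 1, b] + M_witness [a, b - 1]"
      using 3 by (subst M_witness_step) (auto simp: numeral_2_eq_2)
    also have "M_witness [a - 1, b] = (a - 1 + b - 2) choose (a - 1 - 1)"
      using 3 by (intro less.hyps) auto
    also have "M_witness [a, b - 1] = (a + (b - 1) - 2) choose (a - 1)"
      using 3 by (intro less.hyps) auto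
    finally show ?thesis
      by (simp add: c d)
  qed
qed

lemma M_family_exists: "\<exists>M. M_family M"
proof
  have "M_witness (xs @ 2 # ys) = M_witness (xs @ ys)" for xs ys
    by (subst (1 2) M_witness.simps) simp
  then show "M_family M_witness"
    unfolding M_family_def using M_witness_binomial M_witness_step by blast
qed

lemma M_family_unique:
  assumes "M_family M" "M_family N" "length ks \<ge> 2" "\<forall>k\<in>set ks. k \<ge> 2"
  shows "M ks = N ks"
  using assms(3,4)
proof (induction "sum_list ks" arbitrary: ks rule: less_induct)
  case less
  show ?case
  proof (cases "length ks = 2")
    case True
    then obtain a b where "ks = [a, b]"
      by (auto simp: numeral_2_eq_2 length_Suc_conv)
    then show ?thesis
      using assms(1,2) less.prems by (simp add: M_family_def)
  next
    case False
    show ?thesis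
    proof (cases "2 \<in> set ks")
      case True
      then obtain xs ys where ks: "ks = xs @ 2 # ys"
        by (meson split_list)
      have "M (xs @ ys) = N (xs @ ys)"
        using less.prems False ks by (intro less.hyps) auto
      moreover have "length (xs @ ys) \<ge> 2" "\<forall>k\<in>set (xs @ ys). k \<ge> 2"
        using less.prems False ks by auto
      ultimately show ?thesis
        using assms(1,2) unfolding M_family_def ks by metis
    next
      case no2: False
      have ge3: "\<forall>k\<in>set ks. k \<ge> 3"
      proof
        fix k assume "k \<in> set ks"
        then have "k \<ge> 2" "k \<noteq> 2"
          using no2 less.prems(2) by auto
        then show "k \<ge> 3" by simp
      qed
      have "M (ks[i := ks ! i - 1]) = N (ks[i := ks ! i - 1])" if i: "i < length ks" for i
      proof (rule less.hyps)
        have "ks ! i \<ge> 3"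
          using ge3 i by simp
        then show "sum_list (ks[i := ks ! i - 1]) < sum_list ks"
          using i by (intro sum_list_decrement_less) auto
        show "length (ks[i := ks ! i - 1]) \<ge> 2"
          using less.prems by simp
        show "\<forall>k\<in>set (ks[i := ks ! i - 1]). k \<ge> 2"
          using less.prems(2) \<open>ks ! i \<ge> 3\<close> set_update_subset_insert[of ks i "ks ! i - 1"] by fastforce
      qed
      moreover have "M ks = (\<Sum>i<length ks. M (ks[i := ks ! i - 1]))"
        "N ks = (\<Sum>i<length ks. N (ks[i := ks ! i - 1]))"
        using assms(1,2) less.prems(1) ge3 unfolding M_family_def by blast+
      ultimately show ?thesis
        by simp
    qed
  qed
qed

end

theory Submission
  imports Defs
begin

text \<open>
  Call the factor in front of the multinomial coefficient the weight of the pair \<open>(k\<^sub>1, k\<^sub>2)\<close>.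
  The bound is proved by induction on the sum of the entries, for lists in any order, with the
  weight taken at two positions holding the two largest entries. For lists of length 2 the bound
  is an equality. For longer lists an entry 2 can be removed, since both sides are unchanged.
  If all entries are at least 3, the recursion for \<open>M\<close> turns the bound into a weighted average
  over all decrements, and the weight satisfies the averaging identity that expresses Pascal's
  rule for length 2. The only problem is a decrement that pushes one of the two
  chosen entries below a third one; then the third entry takes over its role, and this only
  improves the bound, because the weight is decreasing in the smaller entry.
\<close>

text \<open>For \<open>x\<close>, \<open>y\<close> at least 2 this is the ratio of the binomial
  coefficients (x+y-2 choose x-1) and (x+y-4 choose x-2). Subtraction takes place in the reals, so
  nothing is truncated.\<close>

definition pair_weight :: "nat \<Rightarrow> nat \<Rightarrow> real" where
  "pair_weight x y = ((real x + real y - 2) * (real x + real y - 3)) / ((real x - 1) * (real y - 1))"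

definition shifted_multinomial :: "nat list \<Rightarrow> real" where
  "shifted_multinomial ks = multinomial (sum_list ks - 2 * length ks) (map (\<lambda>k. k - 2) ks)"

text \<open>Positions are recorded instead of sorting the list, because a decrement can destroy
  sortedness. Neither of the two positions is required to hold the larger entry.\<close>

definition top_pair :: "nat list \<Rightarrow> nat \<Rightarrow> nat \<Rightarrow> bool" where
  "top_pair ks j l \<longleftrightarrow> j < length ks \<and> l < length ks \<and> j \<noteq> l \<and>
     (\<forall>m<length ks. m \<noteq> j \<longrightarrow> m \<noteq> l \<longrightarrow> ks ! m \<le> ks ! j \<and> ks ! m \<le> ks ! l)"

section \<open>Algebra of the pair weight\<close>

lemma pair_weight_commute: "pair_weight x y = pair_weight y x"
  by (simp add: pair_weight_def algebra_simps)

lemma top_pair_commute: "top_pair ks j l \<longleftrightarrow> top_pair ks l j"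
  by (auto simp: top_pair_def)

text \<open>Pascal's rule for (x+y-2 choose x-1), divided by (x+y-4 choose x-2): the factors x-2 and
  y-2 over x+y-4 come from lowering one index of the latter coefficient.\<close>

lemma pair_weight_Pascal:
  assumes "x \<ge> 3" "y \<ge> 3"
  shows "(real x - 2) * pair_weight (x - 1) y + (real y - 2) * pair_weight x (y - 1)
       = (real x + real y - 4) * pair_weight x y"
proof -
  define p q where "p = real x - 2" and "q = real y - 2"
  have pq: "p > 0" "q > 0" "real x = p + 2" "real y = q + 2"
    "real (x - 1) = p + 1" "real (y - 1) = q + 1"
    using assms by (auto simp: p_def q_def of_nat_diff)
  have "pair_weight (x - 1) y = (p + q + 1) * (p + q) / (p * (q + 1))"
    and "pair_weight x (y - 1) = (p + q + 1) * (p + q) / (q * (p + 1))"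
    and "pair_weight x y = (p + q + 2) * (p + q + 1) / ((p + 1) * (q + 1))"
    unfolding pair_weight_def pq(3-6) by (simp_all add: algebra_simps)
  moreover have "(p + q + 1) * (p + q) / (q + 1) + (p + q + 1) * (p + q) / (p + 1)
      = (p + q) * ((p + q + 2) * (p + q + 1) / ((p + 1) * (q + 1)))"
    using pq(1,2) by (simp add: divide_simps) algebra
  ultimately show ?thesis
    using pq by simp
qed

lemma pair_weight_decrement_ge:
  assumes "3 \<le> x" "x \<le> y"
  shows "pair_weight x y \<le> pair_weight (x - 1) y"
proof -
  define p q where "p = real x - 2" and "q = real y - 2"
  have pq: "p > 0" "q \<ge> p" "real x = p + 2" "real y = q + 2" "real (x - 1) = p + 1"
    using assms by (auto simp: p_def q_def of_nat_diff)
  \<comment> \<open>The two weights differ by (q-p)(p+q+1) / (p(p+1)(q+1)), and (q-p)(p+q+1) =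
    q(q+1) - p(p+1); hence the sign is decided by x \<le> y.\<close>
  have "p * (p + 1) \<le> q * (q + 1)"
    using pq by (intro mult_mono) auto
  then have "0 \<le> (q * (q + 1) - p * (p + 1)) / (p * (p + 1) * (q + 1))"
    using pq by simp
  also have "\<dots> = (p + q + 1) * (p + q) / (p * (q + 1))
      - (p + q + 2) * (p + q + 1) / ((p + 1) * (q + 1))"
    using pq(1,2) by (simp add: divide_simps) algebra
  finally have "(p + q + 2) * (p + q + 1) / ((p + 1) * (q + 1))
      \<le> (p + q + 1) * (p + q) / (p * (q + 1))"
    by simp
  moreover have "pair_weight x y = (p + q + 2) * (p + q + 1) / ((p + 1) * (q + 1))"
    and "pair_weight (x - 1) y = (p + q + 1) * (p + q) / (p * (q + 1))"
    unfolding pair_weight_def pq(3-5) by (simp_all add: algebra_simps)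
  ultimately show ?thesis
    by simp
qed

lemma binomial_eq_pair_weight:
  assumes "x \<ge> 2" "y \<ge> 2"
  shows "real ((x + y - 2) choose (x - 1)) = pair_weight x y * shifted_multinomial [x, y]"
proof -
  obtain a b where ab: "x = a + 2" "y = b + 2"
    using assms by (metis add.commute le_Suc_ex)
  have "real ((a + b + 2) choose (a + 1)) = fact (a + b + 2) / (fact (a + 1) * fact (b + 1))"
    by (subst binomial_fact) auto
  also have "\<dots> = (real a + real b + 2) * (real a + real b + 1) / ((real a + 1) * (real b + 1))
      * (fact (a + b) / (fact a * fact b))"
  proof -
    have "fact (a + b + 2) = (real a + real b + 2) * (real a + real b + 1) * fact (a + b)"
      by (simp add: algebra_simps)
    moreover have "fact (a + 1) = (real a + 1) * fact a" "fact (b + 1) = (real b + 1) * fact b"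
      by (simp_all add: algebra_simps)
    ultimately show ?thesis
      by (simp only: times_divide_times_eq mult_ac)
  qed
  finally show ?thesis
    by (simp add: ab pair_weight_def shifted_multinomial_def multinomial_def algebra_simps)
qed

section \<open>Multinomial coefficients\<close>

lemma mult_length_le_sum_list:
  fixes ks :: "nat list"
  assumes "\<forall>k\<in>set ks. c \<le> k"
  shows "c * length ks \<le> sum_list ks"
  using assms by (induction ks) auto

lemma shifted_multinomial_nonneg: "shifted_multinomial ks \<ge> 0"
  unfolding shifted_multinomial_def multinomial_def
  by (intro divide_nonneg_nonneg prod_list_nonneg) auto

lemma shifted_multinomial_remove_2:
  "shifted_multinomial (xs @ 2 # ys) = shifted_multinomial (xs @ ys)"
  by (simp add: shifted_multinomial_def multinomial_def)

text \<open>Absorption for multinomial coefficients with lower indices k-2: lowering one of them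
  divides by the total and multiplies by that index.\<close>

lemma shifted_multinomial_decrement:
  assumes "\<forall>k\<in>set ks. k \<ge> 2" "i < length ks" "ks ! i \<ge> 3"
  shows "(real (sum_list ks) - 2 * real (length ks)) * shifted_multinomial (ks[i := ks ! i - 1])
       = (real (ks ! i) - 2) * shifted_multinomial ks"
proof -
  define xs ys where "xs = take i ks" and "ys = drop (Suc i) ks"
  obtain a where a: "ks ! i = a + 3"
    using assms(3) by (metis add.commute le_Suc_ex)
  have ks: "ks = xs @ (a + 3) # ys"
    using id_take_nth_drop[OF assms(2)] by (simp add: xs_def ys_def a)
  have upd: "ks[i := ks ! i - 1] = xs @ (a + 2) # ys"
    using upd_conv_take_nth_drop[OF assms(2)] by (simp add: xs_def ys_def a)
  \<comment> \<open>Writing the surplus over twice the length as a natural number \<open>n\<close>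
    makes the truncated subtractions exact.\<close>
  have "2 * length (xs @ ys) \<le> sum_list (xs @ ys)"
    using assms(1) ks by (intro mult_length_le_sum_list) auto
  then obtain n where n: "sum_list xs + sum_list ys = 2 * (length xs + length ys) + n"
    using le_Suc_ex by auto
  have "sum_list ks - 2 * length ks = Suc (n + a)"
    and "sum_list (xs @ (a + 2) # ys) - 2 * length (xs @ (a + 2) # ys) = n + a"
    using n unfolding ks by simp_all
  moreover have total: "real (sum_list ks) - 2 * real (length ks) = real (Suc (n + a))"
    using arg_cong[OF n, of real] unfolding ks by simp
  ultimately have "shifted_multinomial ks = fact (Suc (n + a)) /
        (fact (Suc a) * ((\<Prod>k\<leftarrow>xs. fact (k - 2)) * (\<Prod>k\<leftarrow>ys. fact (k - 2))))"
    and "shifted_multinomial (xs @ (a + 2) # ys) = fact (n + a) /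
        (fact a * ((\<Prod>k\<leftarrow>xs. fact (k - 2)) * (\<Prod>k\<leftarrow>ys. fact (k - 2))))"
    unfolding shifted_multinomial_def multinomial_def
    by (simp_all add: ks o_def mult_ac)
  moreover have "real (ks ! i) - 2 = real (Suc a)"
    by (simp add: a)
  ultimately show ?thesis
    unfolding upd total by (simp del: of_nat_Suc)
qed

section \<open>Top pairs under decrements and deletions\<close>

lemma top_pair_decrement_other:
  assumes "top_pair ks j l" "i \<noteq> j" "i \<noteq> l"
  shows "top_pair (ks[i := ks ! i - 1]) j l"
proof -
  have "ks[i := ks ! i - 1] ! m \<le> ks ! m" for m
    by (cases "m = i"; cases "i < length ks") (auto simp: list_update_beyond)
  then show ?thesis
    using assms unfolding top_pair_def by (auto intro: le_trans)
qed

lemma top_pair_decrement_left: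
  assumes top: "top_pair ks j l" and ge3: "\<forall>k\<in>set ks. k \<ge> 3"
  shows "\<exists>j' l'. top_pair (ks[j := ks ! j - 1]) j' l' \<and>
    pair_weight (ks[j := ks ! j - 1] ! j') (ks[j := ks ! j - 1] ! l')
       \<le> pair_weight (ks ! j - 1) (ks ! l)"
proof (cases "top_pair (ks[j := ks ! j - 1]) j l")
  case True
  show ?thesis
    by (intro exI[of _ j] exI[of _ l] conjI True) (use top in \<open>simp add: top_pair_def\<close>)
next
  case False
  then obtain m where m: "m < length ks" "m \<noteq> j" "m \<noteq> l" "\<not> (ks ! m \<le> ks ! j - 1 \<and> ks ! m \<le> ks ! l)"
    using top by (auto simp: top_pair_def)
  \<comment> \<open>Position \<open>j\<close> drops by only 1, so it can be overtaken only by an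
    entry \<open>m\<close> tied with it. Then \<open>m\<close> replaces \<open>j\<close>. Since
    \<open>m\<close> lies outside the pair, the tied value is at most \<open>ks ! l\<close>, so it
    is the smaller argument of the weight, and restoring it from its decrement does not raise the
    weight.\<close>
  have eq: "ks ! m = ks ! j"
    using top m by (auto simp: top_pair_def)
  have "ks ! j \<le> ks ! l" "ks ! j \<ge> 3"
    using top m(1-3) ge3 eq by (auto simp: top_pair_def)
  moreover have "top_pair (ks[j := ks ! j - 1]) m l"
    using top m eq by (auto simp: top_pair_def nth_list_update)
  ultimately show ?thesis
    using top m eq pair_weight_decrement_ge[of "ks ! j" "ks ! l"]
    by (intro exI[of _ m] exI[of _ l]) (simp add: top_pair_def)
qed

lemma top_pair_remove:
  assumes top: "top_pair (xs @ k # ys) j l" and "length xs \<noteq> j" "length xs \<noteq> l"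
  obtains j' l' where "top_pair (xs @ ys) j' l'"
    "(xs @ ys) ! j' = (xs @ k # ys) ! j" "(xs @ ys) ! l' = (xs @ k # ys) ! l"
proof -
  \<comment> \<open>\<open>down\<close> and \<open>up\<close> translate indices across the deleted
    position; they are mutually inverse away from it.\<close>
  define down where "down i = (if i < length xs then i else i - 1)" for i
  define up where "up i = (if i < length xs then i else Suc i)" for i
  have up: "(xs @ ys) ! i = (xs @ k # ys) ! up i" "up i \<noteq> length xs" "down (up i) = i" for i
    by (auto simp: up_def down_def nth_append Suc_diff_le)
  have up_less: "up i < length (xs @ k # ys)" if "i < length (xs @ ys)" for i
    using that by (auto simp: up_def)
  have up_down: "up (down i) = i" if "i \<noteq> length xs" for i
    using that by (auto simp: up_def down_def)
  have down_less: "down i < length (xs @ ys)" if "i \<noteq> length xs" "i < length (xs @ k # ys)" for i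
    using that by (auto simp: down_def)
  have "top_pair (xs @ ys) (down j) (down l)"
    unfolding top_pair_def
  proof (intro conjI allI impI)
    show "down j < length (xs @ ys)" "down l < length (xs @ ys)"
      using assms down_less by (auto simp: top_pair_def simp del: length_append)
    show "down j \<noteq> down l"
      using assms up_down[of j] up_down[of l] by (auto simp: top_pair_def)
    fix m assume m: "m < length (xs @ ys)" "m \<noteq> down j" "m \<noteq> down l"
    then have "up m < length (xs @ k # ys)" "up m \<noteq> j" "up m \<noteq> l"
      using up_less up(3) by auto
    then show "(xs @ ys) ! m \<le> (xs @ ys) ! down j" "(xs @ ys) ! m \<le> (xs @ ys) ! down l"
      using top assms(2,3) by (simp_all add: up(1) up_down top_pair_def)
  qed
  then show ?thesis
    using that up(1) up_down assms(2,3) by metis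
qed

section \<open>The recursion and the induction\<close>

lemma M_family_remove_2:
  assumes "M_family M" "length (xs @ ys) \<ge> 2" "\<forall>k\<in>set (xs @ ys). k \<ge> 2"
  shows "M (xs @ 2 # ys) = M (xs @ ys)"
  using assms unfolding M_family_def by blast

text \<open>Outside the pair the weight is constant, and the two terms at \<open>j\<close> and
  \<open>l\<close> combine by \<open>pair_weight_Pascal\<close>. What remains is the sum of all
  k-2.\<close>

lemma weighted_sum_of_decrements:
  assumes top: "top_pair ks j l" and ge3: "\<forall>k\<in>set ks. k \<ge> 3"
  shows "(\<Sum>i<length ks. (if i = j then pair_weight (ks ! j - 1) (ks ! l)
             else if i = l then pair_weight (ks ! j) (ks ! l - 1)
             else pair_weight (ks ! j) (ks ! l)) * (real (ks ! i) - 2))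
       = pair_weight (ks ! j) (ks ! l) * (real (sum_list ks) - 2 * real (length ks))"
    (is "sum ?g _ = ?w * _")
proof -
  have jl: "j < length ks" "l < length ks" "j \<noteq> l"
    using top by (auto simp: top_pair_def)
  let ?R = "{..<length ks} - {j, l}"
  have split: "sum h {..<length ks} = h j + h l + sum h ?R" for h :: "nat \<Rightarrow> real"
  proof -
    have "sum h {..<length ks} = sum h ?R + sum h {j, l}"
      using jl by (intro sum.subset_diff) auto
    then show ?thesis
      using jl by simp
  qed
  have "real (sum_list ks) - 2 * real (length ks) = (\<Sum>i<length ks. real (ks ! i) - 2)"
    by (simp add: sum_list_sum_nth sum_subtractf atLeast0LessThan)
  also have "\<dots> = (real (ks ! j) + real (ks ! l) - 4) + (\<Sum>i\<in>?R. real (ks ! i) - 2)"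
    by (subst split) simp
  finally have total: "real (sum_list ks) - 2 * real (length ks)
      = (real (ks ! j) + real (ks ! l) - 4) + (\<Sum>i\<in>?R. real (ks ! i) - 2)" .
  have "sum ?g {..<length ks} = ?g j + ?g l + sum ?g ?R"
    by (rule split)
  also have "sum ?g ?R = ?w * (\<Sum>i\<in>?R. real (ks ! i) - 2)"
    unfolding sum_distrib_left by (intro sum.cong) auto
  also have "?g j + ?g l = ?w * (real (ks ! j) + real (ks ! l) - 4)"
    using pair_weight_Pascal[of "ks ! j" "ks ! l"] jl ge3 by (simp add: mult.commute)
  finally show ?thesis
    unfolding total by (simp add: distrib_left)
qed

lemma M_family_le_pair_weight:
  assumes M: "M_family M" and "top_pair ks j l" "\<forall>k\<in>set ks. k \<ge> 2"
  shows "real (M ks) \<le> pair_weight (ks ! j) (ks ! l) * shifted_multinomial ks"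
  using assms(2,3)
proof (induction "sum_list ks" arbitrary: ks j l rule: less_induct)
  case less
  note top = less.prems(1)
  have jl: "j < length ks" "l < length ks" "j \<noteq> l"
    using top by (auto simp: top_pair_def)
  then have "length ks \<ge> 2"
    by linarith
  then consider "length ks = 2" | "length ks \<ge> 3" "2 \<in> set ks" | "length ks \<ge> 3" "2 \<notin> set ks"
    by linarith
  then show ?case
  proof cases
    case 1
    then obtain x y where ks: "ks = [x, y]"
      by (auto simp: numeral_2_eq_2 length_Suc_conv)
    have "pair_weight (ks ! j) (ks ! l) = pair_weight x y"
      using jl pair_weight_commute[of x y] by (auto simp: ks less_Suc_eq)
    moreover have "M ks = (x + y - 2) choose (x - 1)"
      using M less.prems(2) by (simp add: M_family_def ks)
    ultimately show ?thesis
      using binomial_eq_pair_weight[of x y] less.prems(2) ks by simp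
  next
    case 2
    \<comment> \<open>If one of the two top entries is 2, then so is every entry outside the pair.\<close>
    have "\<exists>m<length ks. m \<noteq> j \<and> m \<noteq> l \<and> ks ! m = 2"
    proof -
      obtain i where i: "i < length ks" "ks ! i = 2"
        using 2(2) by (auto simp: in_set_conv_nth)
      have "\<not> {..<length ks} \<subseteq> {j, l}"
        using 2(1) card_mono[of "{j, l}" "{..<length ks}"] jl by auto
      then obtain m where m: "m < length ks" "m \<noteq> j" "m \<noteq> l"
        by auto
      have "ks ! m \<ge> 2"
        using less.prems(2) m(1) by simp
      show ?thesis
      proof (cases "i = j \<or> i = l")
        case True
        then have "ks ! m \<le> 2"
          using top m i by (auto simp: top_pair_def)
        then show ?thesis
          using m \<open>ks ! m \<ge> 2\<close> by auto
      qed (use i in auto)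
    qed
    then obtain m where m: "m < length ks" "m \<noteq> j" "m \<noteq> l" "ks ! m = 2"
      by blast
    define xs ys where "xs = take m ks" and "ys = drop (Suc m) ks"
    have ks: "ks = xs @ 2 # ys"
      using id_take_nth_drop[OF m(1)] m(4) by (simp add: xs_def ys_def)
    have "length xs = m"
      using m(1) by (simp add: xs_def)
    then obtain j' l' where top': "top_pair (xs @ ys) j' l'"
      "(xs @ ys) ! j' = ks ! j" "(xs @ ys) ! l' = ks ! l"
      using top_pair_remove[of xs 2 ys j l] top m(2,3) unfolding ks by metis
    have "real (M (xs @ ys))
        \<le> pair_weight ((xs @ ys) ! j') ((xs @ ys) ! l') * shifted_multinomial (xs @ ys)"
      using less.prems(2) ks by (intro less.hyps top') auto
    moreover have "M ks = M (xs @ ys)"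
      unfolding ks using less.prems(2) 2(1) ks by (intro M_family_remove_2[OF M]) auto
    ultimately show ?thesis
      using top'(2,3) by (simp add: ks shifted_multinomial_remove_2)
  next
    case 3
    have ge3: "\<forall>k\<in>set ks. k \<ge> 3"
    proof
      fix k assume "k \<in> set ks"
      then have "k \<ge> 2" "k \<noteq> 2"
        using 3(2) less.prems(2) by auto
      then show "k \<ge> 3" by simp
    qed
    \<comment> \<open>\<open>N\<close> is the sum of all k-2, the upper index of the multinomial
      coefficient. Multiplied by \<open>N\<close>, every decremented coefficient becomes a multiple
      of the original one. \<open>w i\<close> is the weight at the old positions \<open>j\<close>,
      \<open>l\<close> after the decrement at \<open>i\<close>, even if these no longer form a top
      pair.\<close>
    define N where "N = real (sum_list ks) - 2 * real (length ks)"
    define w where "w i = (if i = j then pair_weight (ks ! j - 1) (ks ! l)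
        else if i = l then pair_weight (ks ! j) (ks ! l - 1)
        else pair_weight (ks ! j) (ks ! l))" for i
    have "3 * length ks \<le> sum_list ks"
      using ge3 by (rule mult_length_le_sum_list)
    then have "2 * length ks < sum_list ks"
      using 3(1) by linarith
    then have N: "N > 0"
      by (simp add: N_def)
    have step: "N * real (M (ks[i := ks ! i - 1])) \<le> w i * (real (ks ! i) - 2) * shifted_multinomial ks"
      if i: "i < length ks" for i
    proof -
      let ?ks = "ks[i := ks ! i - 1]"
      have ki: "ks ! i \<ge> 3"
        using ge3 i by simp
      \<comment> \<open>The induction hypothesis needs a genuine top pair of the decremented list;
        its weight only has to be bounded by \<open>w i\<close>.\<close>
      have "\<exists>j' l'. top_pair ?ks j' l' \<and> pair_weight (?ks ! j') (?ks ! l') \<le> w i"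
      proof -
        consider "i = j" | "i = l" | "i \<noteq> j" "i \<noteq> l" by blast
        then show ?thesis
        proof cases
          case 1
          then show ?thesis
            using top_pair_decrement_left[OF top ge3] by (simp add: w_def)
        next
          case 2
          have "top_pair ks l j"
            using top by (simp add: top_pair_commute)
          moreover have "w i = pair_weight (ks ! l - 1) (ks ! j)"
            using 2 jl(3) by (simp add: w_def pair_weight_commute)
          ultimately show ?thesis
            using top_pair_decrement_left[of ks l j] ge3 2 by simp
        next
          case 3
          then show ?thesis
            using top_pair_decrement_other[OF top 3]
            by (intro exI[of _ j] exI[of _ l]) (simp add: w_def)
        qed
      qed
      then obtain j' l' where top': "top_pair ?ks j' l'" and le: "pair_weight (?ks ! j') (?ks ! l') \<le> w i"
        by blast
      have "real (M ?ks) \<le> pair_weight (?ks ! j') (?ks ! l') * shifted_multinomial ?ks"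
      proof (rule less.hyps[OF _ top'])
        show "sum_list ?ks < sum_list ks"
          using i ki by (intro sum_list_decrement_less) auto
        show "\<forall>k\<in>set ?ks. k \<ge> 2"
          using less.prems(2) ki set_update_subset_insert[of ks i "ks ! i - 1"] by fastforce
      qed
      also have "\<dots> \<le> w i * shifted_multinomial ?ks"
        by (intro mult_right_mono le shifted_multinomial_nonneg)
      finally have "N * real (M ?ks) \<le> w i * (N * shifted_multinomial ?ks)"
        using N by (simp add: mult.left_commute)
      then show ?thesis
        using shifted_multinomial_decrement[OF less.prems(2) i ki] by (simp add: N_def mult.assoc)
    qed
    have "M ks = (\<Sum>i<length ks. M (ks[i := ks ! i - 1]))"
      using M ge3 \<open>length ks \<ge> 2\<close> unfolding M_family_def by blast
    then have "N * real (M ks) = (\<Sum>i<length ks. N * real (M (ks[i := ks ! i - 1])))"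
      by (simp add: sum_distrib_left)
    also have "\<dots> \<le> (\<Sum>i<length ks. w i * (real (ks ! i) - 2) * shifted_multinomial ks)"
      by (intro sum_mono step) simp
    also have "\<dots> = (\<Sum>i<length ks. w i * (real (ks ! i) - 2)) * shifted_multinomial ks"
      by (simp add: sum_distrib_right)
    also have "(\<Sum>i<length ks. w i * (real (ks ! i) - 2)) = pair_weight (ks ! j) (ks ! l) * N"
      unfolding w_def N_def by (rule weighted_sum_of_decrements[OF top ge3])
    finally have "N * real (M ks) \<le> N * (pair_weight (ks ! j) (ks ! l) * shifted_multinomial ks)"
      by (simp add: mult_ac)
    then show ?thesis
      using N by simp
  qed
qed

section \<open>Decreasing and constant lists\<close>

lemma top_pair_sorted:
  assumes "sorted_wrt (\<ge>) ks" "length ks \<ge> 2"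
  shows "top_pair ks 0 1"
  unfolding top_pair_def
proof (intro conjI allI impI)
  fix m assume "m < length ks" "m \<noteq> 0" "m \<noteq> 1"
  then show "ks ! m \<le> ks ! 0" "ks ! m \<le> ks ! 1"
    using assms(1) by (auto intro!: sorted_wrt_nth_less[of "(\<ge>)" ks])
qed (use assms(2) in auto)

theorem theorem3p3:
  fixes M :: "nat list \<Rightarrow> nat"
  assumes "M_family M"
  shows "(\<forall>(r::nat) ks. r \<ge> 2 \<longrightarrow> length ks = r \<longrightarrow> sorted_wrt (\<ge>) ks \<longrightarrow> (\<forall>k\<in>set ks. k \<ge> 2) \<longrightarrow>
           real (M ks) \<le>
             ((real (ks ! 0) + real (ks ! 1) - 2) * (real (ks ! 0) + real (ks ! 1) - 3))
               / ((real (ks ! 0) - 1) * (real (ks ! 1) - 1))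
             * multinomial (sum_list ks - 2 * r) (map (\<lambda>k. k - 2) ks))
       \<and> (\<forall>(r::nat) k. r \<ge> 2 \<longrightarrow> k \<ge> 2 \<longrightarrow>
           real (M (replicate r k)) \<le>
             (4 - 2 / (real k - 1)) * (fact (r * (k - 2)) / (fact (k - 2)) ^ r))"
proof (intro conjI allI impI)
  fix r :: nat and ks :: "nat list"
  assume "r \<ge> 2" "length ks = r" "sorted_wrt (\<ge>) ks" "\<forall>k\<in>set ks. k \<ge> 2"
  then show "real (M ks) \<le>
             ((real (ks ! 0) + real (ks ! 1) - 2) * (real (ks ! 0) + real (ks ! 1) - 3))
               / ((real (ks ! 0) - 1) * (real (ks ! 1) - 1))
             * multinomial (sum_list ks - 2 * r) (map (\<lambda>k. k - 2) ks)"
    using M_family_le_pair_weight[OF assms top_pair_sorted, of ks]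
    by (simp add: pair_weight_def shifted_multinomial_def)
next
  fix r k :: nat
  assume rk: "r \<ge> 2" "k \<ge> 2"
  have "top_pair (replicate r k) 0 1"
    using rk by (simp add: top_pair_def)
  then have "real (M (replicate r k)) \<le> pair_weight k k * shifted_multinomial (replicate r k)"
    using M_family_le_pair_weight[OF assms, of "replicate r k" 0 1] rk by simp
  \<comment> \<open>Here (2k-2)(2k-3)/(k-1)^2 = (4(k-1)-2)/(k-1).\<close>
  also have "pair_weight k k = 4 - 2 / (real k - 1)"
    using rk by (simp add: pair_weight_def divide_simps) (simp add: algebra_simps)
  also have "shifted_multinomial (replicate r k) = fact (r * (k - 2)) / fact (k - 2) ^ r"
    by (simp add: shifted_multinomial_def multinomial_def sum_list_replicate diff_mult_distrib2
        mult.commute)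
  finally show "real (M (replicate r k)) \<le>
      (4 - 2 / (real k - 1)) * (fact (r * (k - 2)) / (fact (k - 2)) ^ r)" .
qed

end
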